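(* Let $S$ be a finite set with $|S|=n\ge 1$. Let $D_{\mathrm{LO}}^S=(N,A)$ be the network with node set $N=\{X : X\subseteq S\}$, arc set $A=\{(X,Z)\in N\times N : X\subset Z,\ |Z|=|X|+1\}$, source $s=\varnothing$ and sink $t=S$. Let $\pi:\mathbb{R}^A\to\mathbb{R}^{S\star S}$ be the linear map sending $\Phi\in\mathbb{R}^A$ to the point $x\in\mathbb{R}^{S\star S}$ given, for all distinct $i,j\in S$, by $$x_{(i,j)}:=\sum\{\Phi_a : a=(X,Z)\in A,\ i\in X \text{ and } j\in Z\setminus X\}.$$ Then $\pi$ maps the flow polytope $F(D_{\mathrm{LO}}^S)$ onto the linear order polytope $P_{\mathrm{LO}}^S$, i.e. $\pi(F(D_{\mathrm{LO}}^S))=P_{\mathrm{LO}}^S$. Consequently, the canonical description of $F(D_{\mathrm{LO}}^S)$ is an extended formulation of $P_{\mathrm{LO}}^S$ of size $n\,2^{n-1}$.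
   Context: Notation: $S\star S:=(S\times S)\setminus\{(i,i): i\in S\}$; $\subset$ denotes strict inclusion. Linear order polytope: a linear order on $S$ is an irreflexive, transitive relation $R$ on $S$ that is complete (for distinct $i,j\in S$, $i\,R\,j$ or $j\,R\,i$). For an irreflexive relation $R$ on $S$, its characteristic vector $x^R\in\mathbb{R}^{S\star S}$ has coordinates $(x^R)_{(i,j)}=1$ if $i\,R\,j$ and $0$ otherwise. $P_{\mathrm{LO}}^S$ is the convex hull of the vectors $x^R$, for $R$ ranging over all linear orders on $S$. Flow polytope: let $D=(N,A)$ be an acyclic network (directed graph) with node set $N$, arc set $A$, source $s$ and sink $t$. For a node $v$, $\delta^+(v)$ and $\delta^-(v)$ are the sets of arcs leaving and entering $v$; for $\Phi\in\mathbb{R}^A$ and $B\subseteq A$, $\Phi(B):=\sum_{a\in B}\Phi_a$. The flow polytope $F(D)\subseteq\mathbb{R}^A$ is the polytope whose vertices are the characteristic vectors (in $\{0,1\}^A$) of the arc sets of all directed $s$–$t$ paths in $D$. Its canonical description (a standard fact) is the linear system $$\Phi(\delta^+(v))-\Phi(\delta^-(v))=0\ \ (v\in N\setminus\{s,t\}),\qquad \Phi(\delta^+(s))-\Phi(\delta^-(s))=1,\qquad \Phi_a\ge 0\ \ (a\in A),$$ whose solution set is $F(D)$. Extended formulation: an extended formulation of a polytope $P$ is a linear description (finite system of linear equations and inequalities) of a polytope $Q$ such that some affine map sends $Q$ onto $P$. The size of a linear description is its number of inequalities (equations and variables are not counted); so the canonical description of $F(D)$ has size $|A|$. *)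

theory Defs
  imports "HOL-Analysis.Analysis" "HOL-Library.Function_Algebras" "Graph_Theory.Arc_Walk"
begin

text \<open>
  For a finite index set \<open>I\<close>, the space \<open>\<real>\<^sup>I\<close> is modelled as the subspace of those functions
  \<open>'i \<Rightarrow> real\<close> that vanish outside \<open>I\<close>; the vector space operations on functions are pointwise.
\<close>

instantiation "fun" :: (type, real_vector) real_vector
begin

definition scaleR_fun :: "real \<Rightarrow> ('a \<Rightarrow> 'b) \<Rightarrow> 'a \<Rightarrow> 'b" where
  "scaleR_fun r f = (\<lambda>x. r *\<^sub>R f x)"

instance
  by standard (simp_all add: scaleR_fun_def plus_fun_def scaleR_add_right scaleR_add_left)

end

definition vec_on :: "'i set \<Rightarrow> ('i \<Rightarrow> real) set" where
  "vec_on I = {x. \<forall>i. i \<notin> I \<longrightarrow> x i = 0}"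


section \<open>Linear descriptions and extended formulations\<close>

text \<open>
  A constraint is a pair \<open>(c, b)\<close> of a coefficient vector and a right-hand side. It is read as
  \<open>(\<Sum>k\<in>K. c k * x k) = b\<close> in the first set below and as \<open>(\<Sum>k\<in>K. c k * x k) \<ge> b\<close> in the
  second one, where \<open>K\<close> is the set of variables.
\<close>

record 'k lin_desc =
  vars :: "'k set"
  eqs :: "(('k \<Rightarrow> real) \<times> real) set"
  ineqs :: "(('k \<Rightarrow> real) \<times> real) set"

text \<open>
  Requiring coefficient vectors to vanish outside the variables ensures that a constraint has only
  one representation as a pair, so that the cardinality of \<open>ineqs\<close> counts inequalities.
\<close>

definition wf_lin_desc :: "'k lin_desc \<Rightarrow> bool" where
  "wf_lin_desc L \<longleftrightarrow> finite (vars L) \<and> finite (eqs L) \<and> finite (ineqs L) \<and>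
     fst ` (eqs L \<union> ineqs L) \<subseteq> vec_on (vars L)"

definition solutions :: "'k lin_desc \<Rightarrow> ('k \<Rightarrow> real) set" where
  "solutions L = {x \<in> vec_on (vars L).
     (\<forall>(c, b) \<in> eqs L. (\<Sum>k\<in>vars L. c k * x k) = b) \<and>
     (\<forall>(c, b) \<in> ineqs L. (\<Sum>k\<in>vars L. c k * x k) \<ge> b)}"

definition lin_desc_size :: "'k lin_desc \<Rightarrow> nat" where
  "lin_desc_size L = card (ineqs L)"

definition linear_description_of :: "'k lin_desc \<Rightarrow> ('k \<Rightarrow> real) set \<Rightarrow> bool" where
  "linear_description_of L Q \<longleftrightarrow> wf_lin_desc L \<and> solutions L = Q"

definition affine_map :: "('v::real_vector \<Rightarrow> 'w::real_vector) \<Rightarrow> bool" where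
  "affine_map f \<longleftrightarrow> (\<exists>h c. linear h \<and> f = (\<lambda>x. h x + c))"

definition extended_formulation :: "'k lin_desc \<Rightarrow> ('i \<Rightarrow> real) set \<Rightarrow> bool" where
  "extended_formulation L P \<longleftrightarrow>
     (\<exists>Q. polytope Q \<and> linear_description_of L Q \<and> (\<exists>f. affine_map f \<and> f ` Q = P))"


section \<open>Linear order polytope\<close>

definition linear_orders :: "'a set \<Rightarrow> 'a rel set" where
  "linear_orders S = {R. R \<subseteq> S \<times> S \<and> strict_linear_order_on S R}"

text \<open>
  For an irreflexive \<open>R \<subseteq> S \<times> S\<close> the indicator function of \<open>R\<close> vanishes on the diagonal and outside
  \<open>S \<times> S\<close>, hence it is the characteristic vector of \<open>R\<close>, with coordinates indexed by the pairs of
  distinct elements of \<open>S\<close>.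
\<close>

definition linear_order_polytope :: "'a set \<Rightarrow> ('a \<times> 'a \<Rightarrow> real) set" where
  "linear_order_polytope S = convex hull (indicator ` linear_orders S)"


section \<open>Flow polytope\<close>

text \<open>
  The definitions below are meant for a finite acyclic digraph \<open>D\<close> and nodes \<open>s \<noteq> t\<close>. Vectors with
  \<open>0\<close>/\<open>1\<close> coordinates are always the vertices of their convex hull.
\<close>

definition flow_polytope :: "('v, 'e) pre_digraph \<Rightarrow> 'v \<Rightarrow> 'v \<Rightarrow> ('e \<Rightarrow> real) set" where
  "flow_polytope D s t = convex hull {indicator (set p) | p. pre_digraph.apath D s p t}"

definition net_outflow_coeffs :: "('v, 'e) pre_digraph \<Rightarrow> 'v \<Rightarrow> 'e \<Rightarrow> real" where
  "net_outflow_coeffs D v = (\<lambda>a. indicator (out_arcs D v) a - indicator (in_arcs D v) a)"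

definition canonical_flow_desc :: "('v, 'e) pre_digraph \<Rightarrow> 'v \<Rightarrow> 'v \<Rightarrow> 'e lin_desc" where
  "canonical_flow_desc D s t =
     \<lparr>vars = arcs D,
      eqs = insert (net_outflow_coeffs D s, 1)
              ((\<lambda>v. (net_outflow_coeffs D v, 0)) ` (verts D - {s, t})),
      ineqs = (\<lambda>a. (indicator {a}, 0)) ` arcs D\<rparr>"

lemma sum_net_outflow_coeffs:
  assumes "finite (arcs D)"
  shows "(\<Sum>a\<in>arcs D. net_outflow_coeffs D v a * \<Phi> a) = sum \<Phi> (out_arcs D v) - sum \<Phi> (in_arcs D v)"
proof -
  have "sum \<Phi> B = (\<Sum>a\<in>arcs D. indicator B a * \<Phi> a)" if "B \<subseteq> arcs D" for B
    using that assms by (auto intro!: sum.mono_neutral_cong_left simp: indicator_def)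
  moreover have "out_arcs D v \<subseteq> arcs D" "in_arcs D v \<subseteq> arcs D"
    by (auto simp: out_arcs_def in_arcs_def)
  ultimately show ?thesis
    by (simp add: net_outflow_coeffs_def left_diff_distrib sum_subtractf)
qed

lemma solutions_canonical_flow_desc:
  assumes "finite (arcs D)"
  shows "solutions (canonical_flow_desc D s t) = {\<Phi> \<in> vec_on (arcs D).
     (\<forall>v \<in> verts D - {s, t}. sum \<Phi> (out_arcs D v) - sum \<Phi> (in_arcs D v) = 0) \<and>
     sum \<Phi> (out_arcs D s) - sum \<Phi> (in_arcs D s) = 1 \<and>
     (\<forall>a \<in> arcs D. \<Phi> a \<ge> 0)}"
proof -
  have "(\<Sum>k\<in>arcs D. indicator {a} k * \<Phi> k) = \<Phi> a" if "a \<in> arcs D" for a and \<Phi> :: "_ \<Rightarrow> real"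
    using assms that by (simp add: indicator_def sum.remove[of _ a])
  then show ?thesis
    using assms by (auto simp: solutions_def canonical_flow_desc_def sum_net_outflow_coeffs)
qed

lemma lin_desc_size_canonical_flow_desc:
  "lin_desc_size (canonical_flow_desc D s t) = card (arcs D)"
proof -
  have "inj_on (\<lambda>a. (indicator {a} :: _ \<Rightarrow> real, 0 :: real)) (arcs D)"
    by (rule inj_onI) (metis Pair_inject indicator_eq_1_iff singleton_iff)
  then show ?thesis
    by (simp add: lin_desc_size_def canonical_flow_desc_def card_image)
qed


section \<open>The network of subsets and the projection\<close>

definition lo_network :: "'a set \<Rightarrow> ('a set, 'a set \<times> 'a set) pre_digraph" where
  "lo_network S =
     \<lparr>verts = Pow S,
      arcs = {(X, Z) \<in> Pow S \<times> Pow S. X \<subset> Z \<and> card Z = card X + 1},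
      tail = fst,
      head = snd\<rparr>"

definition lo_projection :: "'a set \<Rightarrow> ('a set \<times> 'a set \<Rightarrow> real) \<Rightarrow> 'a \<times> 'a \<Rightarrow> real" where
  "lo_projection S \<Phi> = (\<lambda>(i, j). if i \<in> S \<and> j \<in> S \<and> i \<noteq> j
     then \<Sum>a | a \<in> arcs (lo_network S) \<and> i \<in> fst a \<and> j \<in> snd a - fst a. \<Phi> a
     else 0)"

lemma linear_lo_projection: "linear (lo_projection S)"
  by (rule linearI)
    (auto simp: lo_projection_def fun_eq_iff scaleR_fun_def sum.distrib sum_distrib_left)

end

theory Submission
  imports Defs
begin

text \<open>
  A nonnegative flow of positive value is positive along some path from the source to the sink.
  Subtracting the largest possible multiple of that path kills an arc of the support, so by
  induction the flow is its value times a convex combination of paths. For the projection, a path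
  in the subset network is a maximal chain, i.e. a way of adding the elements of \<open>S\<close> one by one, and
  its image is the characteristic vector of the relation ``\<open>i\<close> is added before \<open>j\<close>''. All linear
  orders arise in this way, and a linear map commutes with taking convex hulls.
\<close>

section \<open>Preliminaries: positive sums and convexity of solution sets\<close>

lemma pos_sum_obtains:
  fixes f :: "'b \<Rightarrow> real"
  assumes "0 < sum f A"
  obtains a where "a \<in> A" "0 < f a"
  using assms by (meson not_less sum_nonpos)

lemma convex_solutions: "convex (solutions L)"
proof (rule convexI)
  fix x y and u v :: real
  assume x: "x \<in> solutions L" and y: "y \<in> solutions L" and uv: "0 \<le> u" "0 \<le> v" "u + v = 1"
  have eval: "(\<Sum>k\<in>vars L. c k * (u *\<^sub>R x + v *\<^sub>R y) k) =
      u * (\<Sum>k\<in>vars L. c k * x k) + v * (\<Sum>k\<in>vars L. c k * y k)" for c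
    by (simp add: scaleR_fun_def sum_distrib_left sum.distrib algebra_simps)
  have "b \<le> u * p + v * q" if "b \<le> p" "b \<le> q" for b p q :: real
  proof -
    have "b = u * b + v * b" using uv by (simp flip: distrib_right)
    also have "\<dots> \<le> u * p + v * q"
      using that uv by (intro add_mono mult_left_mono)
    finally show ?thesis .
  qed
  moreover have "u * b + v * b = b" for b
    using uv by (simp flip: distrib_right)
  moreover have "u *\<^sub>R x + v *\<^sub>R y \<in> vec_on (vars L)"
    using x y by (simp add: solutions_def vec_on_def scaleR_fun_def)
  ultimately show "u *\<^sub>R x + v *\<^sub>R y \<in> solutions L"
    using x y unfolding solutions_def mem_Collect_eq eval by fastforce
qed

section \<open>Flow decomposition\<close>

text \<open>\<open>rank\<close> is a topological numbering: it witnesses acyclicity and is the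
  induction measure both for tracing flow back to \<open>s\<close> and for following it forward to
  \<open>t\<close>. As no arc enters \<open>s\<close>, the net outflow of \<open>s\<close> is just
  its outflow.\<close>

locale st_network = fin_digraph G for G :: "('v, 'e) pre_digraph" (structure) +
  fixes s t :: 'v and rank :: "'v \<Rightarrow> nat"
  assumes s_in_verts: "s \<in> verts G"
    and t_in_verts: "t \<in> verts G"
    and s_neq_t: "s \<noteq> t"
    and in_arcs_s: "in_arcs G s = {}"
    and out_arcs_t: "out_arcs G t = {}"
    and rank_less: "e \<in> arcs G \<Longrightarrow> rank (tail G e) < rank (head G e)"
begin

text \<open>The value \<open>sum \<Phi> (out_arcs G s)\<close> is left free, because the
  decomposition recurses on remainders of smaller value.\<close>

definition flow :: "('e \<Rightarrow> real) \<Rightarrow> bool" where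
  "flow \<Phi> \<longleftrightarrow> \<Phi> \<in> vec_on (arcs G) \<and> (\<forall>a\<in>arcs G. 0 \<le> \<Phi> a) \<and>
     (\<forall>v\<in>verts G - {s, t}. sum \<Phi> (out_arcs G v) = sum \<Phi> (in_arcs G v))"

lemma flowI:
  assumes "\<And>a. a \<notin> arcs G \<Longrightarrow> \<Phi> a = 0" "\<And>a. a \<in> arcs G \<Longrightarrow> 0 \<le> \<Phi> a"
    "\<And>v. v \<in> verts G \<Longrightarrow> v \<noteq> s \<Longrightarrow> v \<noteq> t \<Longrightarrow> sum \<Phi> (out_arcs G v) = sum \<Phi> (in_arcs G v)"
  shows "flow \<Phi>"
  using assms by (auto simp: flow_def vec_on_def)

lemma flowD:
  assumes "flow \<Phi>"
  shows "a \<notin> arcs G \<Longrightarrow> \<Phi> a = 0" "0 \<le> \<Phi> a"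
    "v \<in> verts G \<Longrightarrow> v \<noteq> s \<Longrightarrow> v \<noteq> t \<Longrightarrow> sum \<Phi> (out_arcs G v) = sum \<Phi> (in_arcs G v)"
  using assms by (cases "a \<in> arcs G"; auto simp: flow_def vec_on_def)+

text \<open>Ranks strictly increase along arcs, so a walk never returns to a node.\<close>

lemma awalk_imp_apath:
  assumes "awalk u p v"
  shows "apath u p v"
proof -
  \<comment> \<open>The rank bound strengthens the induction: the tail of a prepended arc has
    smaller rank than every later node, hence is not among them.\<close>
  have "apath u p v \<and> (\<forall>w\<in>set (awalk_verts u p). rank u \<le> rank w)"
    using assms
  proof (induction p arbitrary: u)
    case Nil
    then show ?case by (auto simp: awalk_Nil_iff apath_Nil_iff)
  next
    case (Cons e p)
    then have e: "e \<in> arcs G" "u = tail G e" "awalk (head G e) p v"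
      by (auto simp: awalk_Cons_iff)
    with Cons.IH rank_less[of e] show ?case
      by (force simp: apath_Cons_iff)
  qed
  then show ?thesis ..
qed

text \<open>The contributions of consecutive arcs telescope. On a path no arc recurs, so the
  indicator of its arc set is the sum of the indicators of its arcs.\<close>

lemma net_outflow_apath:
  assumes "apath u p w"
  shows "sum (indicator (set p) :: _ \<Rightarrow> real) (out_arcs G v) - sum (indicator (set p)) (in_arcs G v) =
    of_bool (u = v) - of_bool (w = v)"
  using assms
proof (induction p arbitrary: u)
  case Nil
  then show ?case by (simp add: apath_Nil_iff)
next
  case (Cons e p)
  then have e: "e \<in> arcs G" "tail G e = u" "apath (head G e) p w"
    and ne: "e \<notin> set p"
    by (auto simp: apath_Cons_iff awalk_verts_conv split: if_splits)
  have split: "(indicator (set (e # p)) :: _ \<Rightarrow> real) = (\<lambda>a. indicator {e} a + indicator (set p) a)"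
    using ne by (auto simp: indicator_def)
  have "sum (indicator {e} :: _ \<Rightarrow> real) (out_arcs G v) = of_bool (u = v)"
    "sum (indicator {e} :: _ \<Rightarrow> real) (in_arcs G v) = of_bool (head G e = v)"
    using e finite_out_arcs[of v] finite_in_arcs[of v] by (auto simp: indicator_def)
  with Cons.IH[OF e(3)] show ?case
    unfolding split by (simp add: sum.distrib)
qed

lemma flow_apath:
  assumes "apath s p t"
  shows "flow (indicator (set p))" "sum (indicator (set p) :: _ \<Rightarrow> real) (out_arcs G s) = 1"
proof -
  have "set p \<subseteq> arcs G"
    using assms by (auto simp: apath_def awalk_def)
  moreover have "sum (indicator (set p) :: _ \<Rightarrow> real) (out_arcs G v) =
      sum (indicator (set p)) (in_arcs G v)"
    if "v \<noteq> s" "v \<noteq> t" for v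
    using net_outflow_apath[OF assms, of v] that by simp
  ultimately show "flow (indicator (set p))"
    by (intro flowI) (auto simp: indicator_def)
  show "sum (indicator (set p) :: _ \<Rightarrow> real) (out_arcs G s) = 1"
    using net_outflow_apath[OF assms, of s] s_neq_t by (simp add: in_arcs_s)
qed

text \<open>Conservation turns positive inflow into positive outflow, which lets a positive walk be
  prolonged until it reaches \<open>t\<close>.\<close>

lemma flow_out_pos:
  assumes "flow \<Phi>" "a \<in> arcs G" "0 < \<Phi> a" "head G a \<noteq> t"
  shows "0 < sum \<Phi> (out_arcs G (head G a))"
proof -
  have "head G a \<noteq> s"
    using assms(2) in_arcs_s by auto
  then have "sum \<Phi> (out_arcs G (head G a)) = sum \<Phi> (in_arcs G (head G a))"
    using assms by (intro flowD) auto
  moreover have "0 < sum \<Phi> (in_arcs G (head G a))"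
    using assms flowD(2)[OF assms(1)] by (intro sum_pos2[of _ a]) auto
  ultimately show ?thesis by simp
qed

lemma flow_in_pos:
  assumes "flow \<Phi>" "a \<in> arcs G" "0 < \<Phi> a" "tail G a \<noteq> s"
  shows "0 < sum \<Phi> (in_arcs G (tail G a))"
proof -
  have "tail G a \<noteq> t"
    using assms(2) out_arcs_t by auto
  then have "sum \<Phi> (out_arcs G (tail G a)) = sum \<Phi> (in_arcs G (tail G a))"
    using assms by (intro flowD) auto
  moreover have "0 < sum \<Phi> (out_arcs G (tail G a))"
    using assms flowD(2)[OF assms(1)] by (intro sum_pos2[of _ a]) auto
  ultimately show ?thesis by simp
qed

text \<open>A positive arc could be traced back through positive arcs with tails of ever smaller
  rank until \<open>s\<close>, where the outflow would be positive.\<close>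

lemma flow_zero:
  assumes "flow \<Phi>" "sum \<Phi> (out_arcs G s) = 0"
  shows "\<Phi> = 0"
proof -
  have "\<not> 0 < \<Phi> a" if "a \<in> arcs G" for a
    using that
  proof (induction "rank (tail G a)" arbitrary: a rule: less_induct)
    case less
    show ?case
    proof
      assume pos: "0 < \<Phi> a"
      show False
      proof (cases "tail G a = s")
        case True
        then have "0 < sum \<Phi> (out_arcs G s)"
          using less.prems pos flowD(2)[OF assms(1)] by (intro sum_pos2[of _ a]) auto
        with assms(2) show False by simp
      next
        case False
        from flow_in_pos[OF assms(1) less.prems pos this] obtain b
          where "b \<in> in_arcs G (tail G a)" "0 < \<Phi> b"
          by (rule pos_sum_obtains)
        with less.hyps[of b] rank_less[of b] show False by auto
      qed
    qed
  qed
  with flowD(1,2)[OF assms(1)] show ?thesis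
    by (metis ext less_eq_real_def zero_fun_apply)
qed

text \<open>Positive arcs are followed forward. Ranks are bounded since there are finitely many
  nodes, so the distance to the maximal rank decreases and the walk must end at
  \<open>t\<close>.\<close>

lemma ex_positive_awalk:
  assumes "flow \<Phi>" "v \<in> verts G" "0 < sum \<Phi> (out_arcs G v)"
  shows "\<exists>p. awalk v p t \<and> (\<forall>a\<in>set p. 0 < \<Phi> a)"
  using assms(2,3)
proof (induction "Max (rank ` verts G) - rank v" arbitrary: v rule: less_induct)
  case less
  obtain a where a: "a \<in> arcs G" "tail G a = v" "0 < \<Phi> a"
    using pos_sum_obtains[OF less.prems(2)] by auto
  have "\<exists>p. awalk (head G a) p t \<and> (\<forall>b\<in>set p. 0 < \<Phi> b)"
  proof (cases "head G a = t")
    case True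
    then show ?thesis
      using t_in_verts by (intro exI[of _ "[]"]) (simp add: awalk_Nil_iff)
  next
    case False
    have "rank v < rank (head G a)" "rank (head G a) \<le> Max (rank ` verts G)"
      using a rank_less[of a] by simp_all
    then have "Max (rank ` verts G) - rank (head G a) < Max (rank ` verts G) - rank v"
      by linarith
    with a flow_out_pos[OF assms(1) a(1,3) False] show ?thesis
      by (intro less.hyps) simp_all
  qed
  then obtain p where "awalk (head G a) p t" "\<forall>b\<in>set p. 0 < \<Phi> b" by blast
  with a show ?case
    by (intro exI[of _ "a # p"]) (auto simp: awalk_Cons_iff)
qed

lemma flow_decomposition:
  assumes "flow \<Phi>" "sum \<Phi> (out_arcs G s) = c" "0 < c"
  shows "\<exists>y\<in>flow_polytope G s t. \<Phi> = c *\<^sub>R y"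
  using assms
proof (induction "card {a \<in> arcs G. \<Phi> a \<noteq> 0}" arbitrary: \<Phi> c rule: less_induct)
  case less
  obtain p where p: "awalk s p t" "\<forall>a\<in>set p. 0 < \<Phi> a"
    using ex_positive_awalk[OF less.prems(1) s_in_verts] less.prems by auto
  then have path: "apath s p t" by (intro awalk_imp_apath)
  define x :: "'e \<Rightarrow> real" where "x = indicator (set p)"
  have x: "x \<in> flow_polytope G s t"
    unfolding flow_polytope_def x_def using path by (intro hull_inc) auto
  have sub: "set p \<subseteq> arcs G" and "p \<noteq> []"
    using p s_neq_t by (auto simp: awalk_def)
  \<comment> \<open>The bottleneck of the path: the largest multiple of \<open>x\<close> that leaves
    the remainder nonnegative. It is attained at an arc \<open>m\<close>, which thereby leaves the
    support.\<close>
  define \<epsilon> where "\<epsilon> = Min (\<Phi> ` set p)"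
  have "\<epsilon> \<in> \<Phi> ` set p"
    unfolding \<epsilon>_def using \<open>p \<noteq> []\<close> by (intro Min_in) auto
  then obtain m where m: "m \<in> set p" "\<epsilon> = \<Phi> m" by auto
  have \<epsilon>_pos: "0 < \<epsilon>" using m p(2) by simp
  have \<epsilon>_le: "\<epsilon> \<le> \<Phi> a" if "a \<in> set p" for a
    using that by (simp add: \<epsilon>_def)
  define \<Psi> where "\<Psi> = (\<lambda>a. \<Phi> a - \<epsilon> * x a)"
  have sum_\<Psi>: "sum \<Psi> A = sum \<Phi> A - \<epsilon> * sum x A" for A
    by (simp add: \<Psi>_def sum_subtractf sum_distrib_left)
  have xflow: "flow x" "sum x (out_arcs G s) = 1"
    using flow_apath[OF path] by (simp_all add: x_def)
  have \<Psi>: "flow \<Psi>"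
  proof (rule flowI)
    show "\<Psi> a = 0" if "a \<notin> arcs G" for a
      using that flowD(1)[OF less.prems(1)] flowD(1)[OF xflow(1)] by (simp add: \<Psi>_def)
    show "0 \<le> \<Psi> a" for a
      using \<epsilon>_le flowD(2)[OF less.prems(1)] by (simp add: \<Psi>_def x_def indicator_def)
    show "sum \<Psi> (out_arcs G v) = sum \<Psi> (in_arcs G v)"
      if "v \<in> verts G" "v \<noteq> s" "v \<noteq> t" for v
      using that flowD(3)[OF less.prems(1)] flowD(3)[OF xflow(1)] by (simp add: sum_\<Psi>)
  qed
  have val: "sum \<Psi> (out_arcs G s) = c - \<epsilon>"
    using less.prems(2) xflow(2) by (simp add: sum_\<Psi>)
  have "0 \<le> c - \<epsilon>"
    unfolding val[symmetric] using flowD(2)[OF \<Psi>] by (simp add: sum_nonneg)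
  have \<Phi>: "\<Phi> = \<epsilon> *\<^sub>R x + \<Psi>"
    by (simp add: \<Psi>_def fun_eq_iff scaleR_fun_def)
  show ?case
  proof (cases "c = \<epsilon>")
    case True
    \<comment> \<open>The induction hypothesis needs positive value, so a remainder of value zero is
      treated separately.\<close>
    then have "\<Psi> = 0" using flow_zero[OF \<Psi>] val by simp
    with \<Phi> True x show ?thesis by auto
  next
    case False
    with \<open>0 \<le> c - \<epsilon>\<close> have "0 < c - \<epsilon>" by simp
    have "m \<in> {a \<in> arcs G. \<Phi> a \<noteq> 0} - {a \<in> arcs G. \<Psi> a \<noteq> 0}"
      using m sub \<epsilon>_pos by (auto simp: \<Psi>_def x_def)
    moreover have "{a \<in> arcs G. \<Psi> a \<noteq> 0} \<subseteq> {a \<in> arcs G. \<Phi> a \<noteq> 0}"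
      using p(2) by (auto simp: \<Psi>_def x_def indicator_def)
    ultimately have "card {a \<in> arcs G. \<Psi> a \<noteq> 0} < card {a \<in> arcs G. \<Phi> a \<noteq> 0}"
      by (intro psubset_card_mono) auto
    from less.hyps[OF this \<Psi> val \<open>0 < c - \<epsilon>\<close>] obtain y
      where y: "y \<in> flow_polytope G s t" "\<Psi> = (c - \<epsilon>) *\<^sub>R y" by blast
    \<comment> \<open>The weights are the shares of the value \<open>c\<close> carried by the path
      and by the remainder.\<close>
    have "(\<epsilon> / c) *\<^sub>R x + ((c - \<epsilon>) / c) *\<^sub>R y \<in> flow_polytope G s t"
      unfolding flow_polytope_def
      using x y(1) \<epsilon>_pos \<open>0 < c - \<epsilon>\<close> less.prems(3)
      by (intro convexD[OF convex_convex_hull]) (auto simp: flow_polytope_def field_simps)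
    moreover have "\<Phi> = c *\<^sub>R ((\<epsilon> / c) *\<^sub>R x + ((c - \<epsilon>) / c) *\<^sub>R y)"
      using less.prems(3) by (simp add: \<Phi> y(2) scaleR_add_right)
    ultimately show ?thesis by blast
  qed
qed

section \<open>The canonical description of the flow polytope\<close>

lemma solutions_canonical_flow_desc_eq:
  "solutions (canonical_flow_desc G s t) = {\<Phi>. flow \<Phi> \<and> sum \<Phi> (out_arcs G s) = 1}"
  by (auto simp: solutions_canonical_flow_desc flow_def in_arcs_s)

text \<open>Path vectors solve the system and its solution set is convex, so it contains their hull.
  Conversely, a solution is a flow of value 1, and its decomposition is then a plain convex
  combination.\<close>

lemma solutions_eq_flow_polytope:
  "solutions (canonical_flow_desc G s t) = flow_polytope G s t"
proof
  show "flow_polytope G s t \<subseteq> solutions (canonical_flow_desc G s t)"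
    unfolding flow_polytope_def
    by (intro hull_minimal convex_solutions) (auto simp: solutions_canonical_flow_desc_eq flow_apath)
  show "solutions (canonical_flow_desc G s t) \<subseteq> flow_polytope G s t"
    using flow_decomposition[of _ 1] by (fastforce simp: solutions_canonical_flow_desc_eq)
qed

lemma wf_canonical_flow_desc: "wf_lin_desc (canonical_flow_desc G s t)"
  by (auto simp: wf_lin_desc_def canonical_flow_desc_def vec_on_def net_outflow_coeffs_def
      indicator_def)

lemma linear_description_of_flow_polytope:
  "linear_description_of (canonical_flow_desc G s t) (flow_polytope G s t)"
  by (simp add: linear_description_of_def wf_canonical_flow_desc solutions_eq_flow_polytope)

lemma polytope_flow_polytope: "polytope (flow_polytope G s t)"
proof -
  \<comment> \<open>There are only finitely many generators: each is the indicator of a subset of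
    the finite arc set.\<close>
  have "{indicator (set p) :: _ \<Rightarrow> real | p. apath s p t} \<subseteq> indicator ` Pow (arcs G)"
    by (auto simp: apath_def awalk_def)
  then have "finite {indicator (set p) :: _ \<Rightarrow> real | p. apath s p t}"
    by (rule finite_subset) simp
  then show ?thesis
    unfolding polytope_def flow_polytope_def by blast
qed

end


section \<open>Maximal chains of subsets and linear orders\<close>

lemma lo_network_simps [simp]:
  "verts (lo_network S) = Pow S" "tail (lo_network S) = fst" "head (lo_network S) = snd"
  by (simp_all add: lo_network_def)

text \<open>Indexing arcs by the added element and the tail makes them easy to count:
  \<open>card S\<close> elements, with \<open>2 ^ (card S - 1)\<close> tails each.\<close>

lemma arcs_lo_network:
  assumes "finite S"
  shows "arcs (lo_network S) = (\<lambda>(j, X). (X, insert j X)) ` (SIGMA j:S. Pow (S - {j}))"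
proof (intro set_eqI iffI)
  fix a assume "a \<in> arcs (lo_network S)"
  then obtain X Z where a: "a = (X, Z)" "X \<subset> Z" "Z \<subseteq> S" "card Z = card X + 1"
    by (auto simp: lo_network_def)
  then have "finite Z" using assms finite_subset by blast
  then have "card (Z - X) = 1"
    using a by (subst card_Diff_subset) (auto intro: finite_subset)
  then obtain j where "Z - X = {j}" by (rule card_1_singletonE)
  with a show "a \<in> (\<lambda>(j, X). (X, insert j X)) ` (SIGMA j:S. Pow (S - {j}))"
    by (intro image_eqI[of _ _ "(j, X)"]) auto
next
  fix a assume "a \<in> (\<lambda>(j, X). (X, insert j X)) ` (SIGMA j:S. Pow (S - {j}))"
  then obtain j X where a: "a = (X, insert j X)" "j \<in> S" "X \<subseteq> S" "j \<notin> X" by auto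
  then show "a \<in> arcs (lo_network S)"
    using finite_subset[OF a(3) assms] by (auto simp: lo_network_def)
qed

lemma card_arcs_lo_network:
  assumes "finite S"
  shows "card (arcs (lo_network S)) = card S * 2 ^ (card S - 1)"
proof -
  have "inj_on (\<lambda>(j, X). (X, insert j X)) (SIGMA j:S. Pow (S - {j}))"
    by (rule inj_onI) auto
  then show ?thesis
    using assms by (simp add: arcs_lo_network card_image card_Pow)
qed

lemma lo_arcE:
  assumes "finite S" "a \<in> arcs (lo_network S)"
  obtains j where "j \<in> S" "fst a \<subseteq> S" "j \<notin> fst a" "snd a = insert j (fst a)"
proof -
  obtain j X where "a = (X, insert j X)" "j \<in> S" "X \<subseteq> S - {j}"
    using assms by (auto simp: arcs_lo_network)
  then show thesis by (intro that[of j]) auto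
qed

text \<open>Cardinality grows by one along each arc, so it serves as the rank; source and sink
  differ because \<open>S\<close> is nonempty.\<close>

lemma st_network_lo_network:
  assumes "finite S" "S \<noteq> {}"
  shows "st_network (lo_network S) {} S card"
proof
  show "finite (arcs (lo_network S))"
    by (simp add: arcs_lo_network assms)
qed (use assms in \<open>auto simp: lo_network_def\<close>)

section \<open>Walks in the subset network and the orders they induce\<close>

definition path_order :: "('a set \<times> 'a set) list \<Rightarrow> 'a rel" where
  "path_order p = {(i, j). \<exists>a\<in>set p. i \<in> fst a \<and> j \<in> snd a - fst a}"

context
  fixes S :: "'a set"
  assumes fin: "finite S" and ne: "S \<noteq> {}"
begin

interpretation st_network "lo_network S" "{}" S card
  by (rule st_network_lo_network[OF fin ne])

lemma awalk_lo_chain: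
  assumes "awalk X p Z"
  shows "sorted_wrt (\<lambda>a b. snd a \<subseteq> fst b) p"
    "\<And>j. j \<in> Z - X \<Longrightarrow> \<exists>a\<in>set p. j \<in> snd a - fst a"
proof -
  \<comment> \<open>The containment of \<open>X\<close> in all tails is carried along so that a
    prepended arc can be compared with every later one.\<close>
  have "sorted_wrt (\<lambda>a b. snd a \<subseteq> fst b) p \<and> (\<forall>a\<in>set p. X \<subseteq> fst a) \<and>
    (\<forall>j\<in>Z - X. \<exists>a\<in>set p. j \<in> snd a - fst a)"
    using assms
  proof (induction p arbitrary: X)
    case Nil
    then show ?case by (simp add: awalk_Nil_iff)
  next
    case (Cons a p)
    then have a: "a \<in> arcs (lo_network S)" "X = fst a" "awalk (snd a) p Z"
      by (auto simp: awalk_Cons_iff)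
    then have "X \<subseteq> snd a" by (auto elim: lo_arcE[OF fin])
    with Cons.IH[OF a(3)] a(2) show ?case by (simp; blast)
  qed
  then show "sorted_wrt (\<lambda>a b. snd a \<subseteq> fst b) p"
    "\<And>j. j \<in> Z - X \<Longrightarrow> \<exists>a\<in>set p. j \<in> snd a - fst a"
    by blast+
qed

lemma awalk_lo_comparable:
  assumes "awalk X p Z" "a \<in> set p" "b \<in> set p"
  shows "a = b \<or> snd a \<subseteq> fst b \<or> snd b \<subseteq> fst a"
  using awalk_lo_chain(1)[OF assms(1)] assms(2,3)
  by (metis in_set_conv_nth nat_neq_iff sorted_wrt_iff_nth_less)

text \<open>Of two distinct arcs on the walk, the later one would already have \<open>j\<close> in
  its tail: each element is added at most once.\<close>

lemma awalk_lo_arc_unique: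
  assumes "awalk X p Z" "a \<in> set p" "b \<in> set p" "j \<in> snd a - fst a" "j \<in> snd b - fst b"
  shows "a = b"
  using awalk_lo_comparable[OF assms(1-3)] assms(4,5) by blast

lemma path_order_linear:
  assumes "awalk {} p S"
  shows "path_order p \<in> linear_orders S"
proof -
  have arc: "\<exists>j. j \<in> S \<and> fst a \<subseteq> S \<and> j \<notin> fst a \<and> snd a = insert j (fst a)" if "a \<in> set p" for a
    using that assms by (meson awalk_def lo_arcE[OF fin] subsetD)
  note comp = awalk_lo_comparable[OF assms]
  have "path_order p \<subseteq> S \<times> S"
    using arc by (force simp: path_order_def)
  moreover have "irrefl (path_order p)"
    using awalk_lo_arc_unique[OF assms] by (auto simp: path_order_def irrefl_def)
  moreover have "trans (path_order p)"
  proof (rule transI)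
    fix i j k assume "(i, j) \<in> path_order p" "(j, k) \<in> path_order p"
    then obtain a b where ab: "a \<in> set p" "i \<in> fst a" "j \<in> snd a - fst a"
      "b \<in> set p" "j \<in> fst b" "k \<in> snd b - fst b"
      by (auto simp: path_order_def)
    moreover have "fst a \<subseteq> snd a" "fst b \<subseteq> snd b"
      using arc[OF ab(1)] arc[OF ab(4)] by auto
    \<comment> \<open>Both \<open>a = b\<close> and \<open>snd b \<subseteq> fst a\<close> would put
      \<open>j\<close> into \<open>fst a\<close>, so \<open>a\<close> precedes
      \<open>b\<close>.\<close>
    ultimately have "i \<in> fst b"
      using comp[OF ab(1,4)] by blast
    with ab show "(i, k) \<in> path_order p"
      by (auto simp: path_order_def)
  qed
  moreover have "total_on S (path_order p)"
  proof (rule total_onI)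
    fix i j assume ij: "i \<in> S" "j \<in> S" "i \<noteq> j"
    then obtain a b where ab: "a \<in> set p" "i \<in> snd a - fst a" "b \<in> set p" "j \<in> snd b - fst b"
      using awalk_lo_chain(2)[OF assms] by (metis Diff_empty)
    \<comment> \<open>An arc adds a single element, so \<open>i\<close> and \<open>j\<close> come
      from different arcs, and the earlier arc decides the direction.\<close>
    then have "a \<noteq> b" using arc[OF ab(1)] ij by auto
    with comp[OF ab(1,3)] ab show "(i, j) \<in> path_order p \<or> (j, i) \<in> path_order p"
      by (auto simp: path_order_def)
  qed
  ultimately show ?thesis
    by (simp add: linear_orders_def strict_linear_order_on_def)
qed

text \<open>Exactly one arc of the walk adds \<open>j\<close>, so the sum defining the coordinate
  \<open>(i, j)\<close> has at most one nonzero term, present precisely when \<open>i\<close> lies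
  in the tail of that arc.\<close>

lemma lo_projection_path:
  assumes "awalk {} p S"
  shows "lo_projection S (indicator (set p)) = indicator (path_order p)"
proof (rule ext, clarify)
  fix i j
  have lin: "path_order p \<subseteq> S \<times> S" "irrefl (path_order p)"
    using path_order_linear[OF assms] by (auto simp: linear_orders_def strict_linear_order_on_def)
  show "lo_projection S (indicator (set p)) (i, j) = indicator (path_order p) (i, j)"
  proof (cases "i \<in> S \<and> j \<in> S \<and> i \<noteq> j")
    case False
    with lin have "(i, j) \<notin> path_order p" by (auto simp: irrefl_def)
    with False show ?thesis by (auto simp: lo_projection_def)
  next
    case True
    let ?B = "{a. a \<in> arcs (lo_network S) \<and> i \<in> fst a \<and> j \<in> snd a - fst a}"
    obtain a where a: "a \<in> set p" "j \<in> snd a - fst a"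
      using True awalk_lo_chain(2)[OF assms] by (metis Diff_empty)
    have uniq: "b = a" if "b \<in> set p" "j \<in> snd b - fst b" for b
      using awalk_lo_arc_unique[OF assms that(1) a(1) that(2) a(2)] .
    have "a \<in> arcs (lo_network S)" using a assms by (auto simp: awalk_def)
    then have "b \<in> ?B \<inter> set p \<longleftrightarrow> b = a \<and> i \<in> fst a" for b
      using a uniq by blast
    then have B: "?B \<inter> set p = (if i \<in> fst a then {a} else {})"
      by (simp add: set_eq_iff)
    have "(i, j) \<in> path_order p \<longleftrightarrow> i \<in> fst a"
      unfolding path_order_def using a uniq by blast
    moreover have "finite ?B" by simp
    then have "(\<Sum>b\<in>?B. indicator (set p) b) = (\<Sum>b\<in>?B \<inter> set p. 1 :: real)"
      by (simp only: indicator_def of_bool_def sum.inter_restrict)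
    then have "(\<Sum>b\<in>?B. indicator (set p) b :: real) = of_bool (i \<in> fst a)"
      unfolding B by simp
    ultimately show ?thesis
      using True by (simp add: lo_projection_def indicator_def)
  qed
qed

text \<open>
  Starting from a downset, repeatedly adding the least missing element yields a maximal chain
  whose arcs all have a principal downset as tail.
\<close>

lemma ex_awalk_downsets:
  assumes R: "R \<in> linear_orders S" and "X \<subseteq> S" "\<And>i j. (i, j) \<in> R \<Longrightarrow> j \<in> X \<Longrightarrow> i \<in> X"
  shows "\<exists>p. awalk X p S \<and> (\<forall>a\<in>set p. \<forall>j\<in>snd a - fst a. fst a = {i. (i, j) \<in> R})"
  using assms(2,3)
proof (induction "card (S - X)" arbitrary: X rule: less_induct)
  case less
  have R': "R \<subseteq> S \<times> S" "trans R" "irrefl R" "total_on S R"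
    using R by (auto simp: linear_orders_def strict_linear_order_on_def)
  show ?case
  proof (cases "X = S")
    case True
    then show ?thesis by (intro exI[of _ "[]"]) (simp add: awalk_Nil_iff)
  next
    case False
    have "finite R" using R'(1) fin by (meson finite_SigmaI finite_subset)
    moreover have "acyclic R" using R' by (simp add: acyclic_irrefl)
    ultimately have "wf R" by (rule finite_acyclic_wf)
    moreover have "S - X \<noteq> {}" using False less.prems(1) by auto
    \<comment> \<open>A finite strict order is well-founded, so the missing elements have a minimal
      one.\<close>
    ultimately obtain j where j: "j \<in> S - X" "\<And>i. (i, j) \<in> R \<Longrightarrow> i \<notin> S - X"
      by (metis wfE_min ex_in_conv)
    \<comment> \<open>Totality and downward closure of \<open>X\<close> put all of \<open>X\<close>
      below \<open>j\<close>; minimality of \<open>j\<close> puts everything below \<open>j\<close>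
      into \<open>X\<close>.\<close>
    have X: "X = {i. (i, j) \<in> R}"
    proof (intro set_eqI iffI CollectI)
      fix i assume i: "i \<in> X"
      with less.prems(2) j have "(j, i) \<notin> R" "i \<noteq> j" by auto
      with R'(4) i j less.prems(1) show "(i, j) \<in> R" by (auto simp: total_on_def)
    next
      fix i assume "i \<in> {i. (i, j) \<in> R}"
      with j R'(1) show "i \<in> X" by auto
    qed
    have "card (S - insert j X) < card (S - X)"
      using j(1) fin by (intro psubset_card_mono) auto
    moreover have "insert j X \<subseteq> S" using j less.prems by auto
    moreover have "i \<in> insert j X" if "(i, k) \<in> R" "k \<in> insert j X" for i k
      using that less.prems(2) X by auto
    ultimately obtain p where p: "awalk (insert j X) p S"
      "\<forall>a\<in>set p. \<forall>j\<in>snd a - fst a. fst a = {i. (i, j) \<in> R}"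
      using less.hyps[of "insert j X"] by blast
    have "(X, insert j X) \<in> arcs (lo_network S)"
      using j less.prems(1) fin by (force simp: arcs_lo_network)
    with p(1) have "awalk X ((X, insert j X) # p) S"
      by (simp add: awalk_Cons_iff)
    with p(2) X show ?thesis
      by (intro exI[of _ "(X, insert j X) # p"]) auto
  qed
qed

text \<open>The walk is started at the empty downset. The arc adding \<open>j\<close> has the
  predecessors of \<open>j\<close> as its tail, so being added before \<open>j\<close> means being
  \<open>R\<close>-below \<open>j\<close>.\<close>

lemma ex_path_order:
  assumes R: "R \<in> linear_orders S"
  shows "\<exists>p. awalk {} p S \<and> path_order p = R"
proof -
  obtain p where p: "awalk {} p S"
    "\<And>a j. a \<in> set p \<Longrightarrow> j \<in> snd a - fst a \<Longrightarrow> fst a = {i. (i, j) \<in> R}"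
    using ex_awalk_downsets[OF R, of "{}"] by blast
  have "path_order p \<subseteq> R"
    using p(2) by (fastforce simp: path_order_def)
  moreover have "R \<subseteq> path_order p"
  proof clarify
    fix i j assume ij: "(i, j) \<in> R"
    then have "j \<in> S" using R by (auto simp: linear_orders_def)
    then obtain a where "a \<in> set p" "j \<in> snd a - fst a"
      using awalk_lo_chain(2)[OF p(1)] by blast
    with p(2) ij show "(i, j) \<in> path_order p"
      unfolding path_order_def by blast
  qed
  ultimately show ?thesis using p(1) by blast
qed

section \<open>The image of the flow polytope and the extended formulation\<close>

lemma lo_projection_flow_polytope:
  "lo_projection S ` flow_polytope (lo_network S) {} S = linear_order_polytope S"
proof -
  \<comment> \<open>By acyclicity walks and paths coincide, so the results on walks apply to all
    generators.\<close>
  have "lo_projection S ` {indicator (set p) | p. apath {} p S} =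
      {lo_projection S (indicator (set p)) | p. awalk {} p S}"
    using awalk_imp_apath awalkI_apath by blast
  also have "\<dots> = {indicator (path_order p) | p. awalk {} p S}"
    using lo_projection_path by metis
  also have "\<dots> = indicator ` linear_orders S"
    using path_order_linear ex_path_order by blast
  finally show ?thesis
    by (simp add: flow_polytope_def linear_order_polytope_def
        convex_hull_linear_image[OF linear_lo_projection])
qed

lemma extended_formulation_lo_network:
  "extended_formulation (canonical_flow_desc (lo_network S) {} S) (linear_order_polytope S)"
proof -
  have "affine_map (lo_projection S)"
    unfolding affine_map_def
    by (intro exI[of _ "lo_projection S"] exI[of _ 0]) (simp add: linear_lo_projection)
  then show ?thesis
    unfolding extended_formulation_def
    using polytope_flow_polytope linear_description_of_flow_polytope lo_projection_flow_polytope
    by blast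
qed

end

theorem theorem1:
  fixes S :: "'a set" and n :: nat
  assumes "finite S" and "card S = n" and "n \<ge> 1"
  shows "lo_projection S ` flow_polytope (lo_network S) {} S = linear_order_polytope S \<and>
    linear_description_of (canonical_flow_desc (lo_network S) {} S)
      (flow_polytope (lo_network S) {} S) \<and>
    extended_formulation (canonical_flow_desc (lo_network S) {} S) (linear_order_polytope S) \<and>
    lin_desc_size (canonical_flow_desc (lo_network S) {} S) = n * 2 ^ (n - 1)"
proof -
  have ne: "S \<noteq> {}" using assms by auto
  interpret st_network "lo_network S" "{}" S card
    by (rule st_network_lo_network[OF assms(1) ne])
  show ?thesis
    using assms ne
    by (simp add: lo_projection_flow_polytope linear_description_of_flow_polytope
        extended_formulation_lo_network lin_desc_size_canonical_flow_desc card_arcs_lo_network)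
qed

end
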